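(* The Minkowski function $\mathbf{?}$ is a stationary distribution function for the Markov chain $(W_n^w)$ on $[0,1]$ defined by $W_0^w=w\in[0,1]$ and $W_{n+1}^w=H_{I_{n+1}}(W_n^w)$ for $n=0,1,\dots$.
   Context: The maps $H_i:[0,1]\to[0,1]$ are $H_0(x)=x$, $H_1(x)=\frac{1}{1+x}$, $H_2(x)=1-x$, $H_3(x)=\min\left\{\frac{x}{1-x},\frac{1-x}{x}\right\}$ (with value $0$ at $x=0$ and $x=1$), $H_4(x)=\frac{x}{1+x}$. The sequence $(I_n)_{n\ge1}$ is i.i.d. with values in $\{0,1,2,3,4\}$ and law $\rho$ given by $\rho(\{0\})=1/9$ and $\rho(\{i\})=2/9$ for $i=1,2,3,4$. For positive integers $k_1,k_2,\dots$, $[k_1,k_2,\dots]=\frac{1}{k_1+\frac{1}{k_2+\cdots}}$ is the infinite continued fraction; every irrational number in $(0,1)$ has a unique such expansion. The Minkowski question mark function is $\mathbf{?}([k_1,k_2,\dots])=2\sum_{n=1}^\infty(-1)^{n+1}2^{-\sum_{j=1}^n k_j}$ at irrational points of $(0,1)$, extended by continuity to $[0,1]$. *)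

theory Defs
  imports "HOL-Probability.Probability"
begin

section \<open>The random maps and the chain\<close>

text \<open>Only the indices 0 to 4 and arguments in the unit interval matter; indices above 4 are
  never used.\<close>

definition H :: "nat \<Rightarrow> real \<Rightarrow> real" where
  "H i x =
    (if i = 0 then x
     else if i = 1 then 1 / (1 + x)
     else if i = 2 then 1 - x
     else if i = 3 then (if x = 0 \<or> x = 1 then 0 else min (x / (1 - x)) ((1 - x) / x))
     else x / (1 + x))"

definition rho :: "nat pmf" where
  "rho = pmf_of_list [(0, 1/9), (1, 2/9), (2, 2/9), (3, 2/9), (4, 2/9)]"

text \<open>\<^const>\<open>pmf_of_list\<close> is only meaningful for well-formed lists; the following
  confirms the intended weights.\<close>

lemma pmf_rho:
  "pmf rho i = (if i = 0 then 1/9 else if i \<in> {1, 2, 3, 4} then 2/9 else 0)"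
proof -
  have "pmf_of_list_wf [(0 :: nat, 1/9 :: real), (1, 2/9), (2, 2/9), (3, 2/9), (4, 2/9)]"
    by (intro pmf_of_list_wfI) auto
  then show ?thesis
    unfolding rho_def by (subst pmf_pmf_of_list) auto
qed

primrec W :: "(nat \<Rightarrow> 'a \<Rightarrow> nat) \<Rightarrow> real \<Rightarrow> nat \<Rightarrow> 'a \<Rightarrow> real" where
  "W I w 0 = (\<lambda>\<omega>. w)"
| "W I w (Suc n) = (\<lambda>\<omega>. H (I (Suc n) \<omega>) (W I w n \<omega>))"

section \<open>Stationary distributions\<close>

abbreviation unit_borel :: "real measure" where
  "unit_borel \<equiv> restrict_space borel {0..1}"

text \<open>Here \<open>K n w\<close> is the law at time \<open>n\<close> of the chain started at the point \<open>w\<close>. The measure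
  \<open>\<mu> \<bind> K n\<close> is the law at time \<open>n\<close> when the chain starts from \<open>\<mu>\<close>; in particular \<open>K 1\<close> is the
  one-step transition kernel.\<close>

definition stationary_distribution ::
    "'s measure \<Rightarrow> (nat \<Rightarrow> 's \<Rightarrow> 's measure) \<Rightarrow> 's measure \<Rightarrow> bool" where
  "stationary_distribution S K \<mu> \<longleftrightarrow>
     \<mu> \<in> space (prob_algebra S) \<and>
     (\<forall>n. K n \<in> S \<rightarrow>\<^sub>M prob_algebra S \<and> \<mu> \<bind> K n = \<mu>)"

text \<open>The library's \<^const>\<open>cdf\<close> uses the half-lines \<open>{..x}\<close>, which are not measurable sets
  of a measure living on the unit interval.\<close>

definition stationary_distribution_function ::
    "(nat \<Rightarrow> real \<Rightarrow> real measure) \<Rightarrow> (real \<Rightarrow> real) \<Rightarrow> bool" where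
  "stationary_distribution_function K F \<longleftrightarrow>
     (\<exists>\<mu>. stationary_distribution unit_borel K \<mu> \<and> (\<forall>x\<in>{0..1}. F x = measure \<mu> {0..x}))"

section \<open>The Minkowski question mark function\<close>

text \<open>Sequences of partial quotients are indexed from 0: the entry \<open>k j\<close> is the
  mathematical $k_{j+1}$.\<close>

primrec cf_truncated :: "nat \<Rightarrow> (nat \<Rightarrow> nat) \<Rightarrow> real" where
  "cf_truncated 0 k = 0"
| "cf_truncated (Suc n) k = 1 / (real (k 0) + cf_truncated n (\<lambda>j. k (Suc j)))"

definition cf_expansion :: "(nat \<Rightarrow> nat) \<Rightarrow> real \<Rightarrow> bool" where
  "cf_expansion k x \<longleftrightarrow> (\<forall>j. k j > 0) \<and> (\<lambda>n. cf_truncated n k) \<longlonglongrightarrow> x"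

definition minkowski_irrational :: "real \<Rightarrow> real" where
  "minkowski_irrational x =
     (let k = (THE k. cf_expansion k x)
      in 2 * (\<Sum>n. (-1) ^ n * (1 / 2 ^ (\<Sum>j\<le>n. k j))))"

text \<open>The value at a rational point of the unit interval is the limit along irrational points,
  one-sided at 0 and 1. Values outside the unit interval are irrelevant.\<close>

definition minkowski :: "real \<Rightarrow> real" where
  "minkowski x =
     (if x \<in> {0<..<1} - \<rat> then minkowski_irrational x
      else Lim (at x within {0<..<1} - \<rat>) minkowski_irrational)"

end

theory Submission
  imports Defs
begin

text \<open>
  In the coordinate \<open>u = ?(x)\<close> the five maps become piecewise affine. Write \<open>q\<close> for the question mark
  function. The identities \<open>q (x / (1 + x)) = q x / 2\<close>, \<open>q (1 / (1 + x)) = 1 - q x / 2\<close> and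
  \<open>q (1 - x) = 1 - q x\<close> turn the maps \<open>H 0, \<dots>, H 4\<close> into \<open>u\<close>, \<open>1 - u / 2\<close>, \<open>1 - u\<close>, the tent map and
  \<open>u / 2\<close>. The first, the third and the tent map preserve the uniform law; \<open>u / 2\<close> and \<open>1 - u / 2\<close> carry
  it to the uniform laws on the two halves of the unit interval, and since both are chosen with the
  same probability their mixture is uniform again. Pulled back to \<open>x\<close>, this says that the law with
  distribution function \<open>q\<close> is invariant under one step of the chain. The lemma
  \<open>minkowski_measure_one_step\<close> carries this out with distribution functions, and a conditioning on
  the last map (\<open>emeasure_W_Suc\<close>) extends it to every time \<open>n\<close>.

  The analytic work is to show that the function given by continued fractions is continuous and
  monotone and satisfies the identities. The first two are the fixed point equation \<open>q = farey_step q\<close> of an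
  operator that halves uniform distances, read on the two inverse branches of the Farey map. Its
  iterates from the identity, all of them continuous and monotone, therefore converge uniformly, and
  the limit, called \<open>question_mark\<close> below, is continuous, monotone and a fixed point. The reflection
  identity follows from the other two.

  That \<open>question_mark\<close> agrees with the alternating series is almost immediate: iterating the two
  identities gives \<open>q (1 / (k + x)) = 2 / 2 ^ k - q x / 2 ^ k\<close>, and so the value of \<open>question_mark\<close> at
  a finite continued fraction is exactly a partial sum of the series
  (\<open>question_mark_cf_truncated\<close>). Continuity passes this to infinite continued fractions. What
  remains is that every irrational point has exactly one continued fraction expansion, and at
  rational points the limit defining \<open>minkowski\<close> is evaluated by continuity.
\<close>

section \<open>The fixed point of the Farey operator\<close>

text \<open>The maps \<open>x / (1 - x)\<close> and \<open>(1 - x) / x\<close> are the two branches of the Farey map, which stretches each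
  half of the unit interval over the whole of it; the right branch reverses orientation.\<close>

definition farey_step :: "(real \<Rightarrow> real) \<Rightarrow> real \<Rightarrow> real" where
  "farey_step f x = (if x \<le> 1 / 2 then f (x / (1 - x)) / 2 else 1 - f ((1 - x) / x) / 2)"

text \<open>By \<open>iterate_uniform_limit\<close> this is the uniform limit on the unit interval, the unique fixed point
  there of \<^const>\<open>farey_step\<close> among bounded functions. Values outside the unit interval carry no
  meaning.\<close>

definition question_mark :: "real \<Rightarrow> real" where
  "question_mark x = lim (\<lambda>n. (farey_step ^^ n) id x)"

lemma farey_left_mem:
  fixes x :: real
  assumes "0 \<le> x" "x \<le> 1 / 2"
  shows "x / (1 - x) \<in> {0..1}"
  using assms by (auto simp: divide_simps)

lemma farey_right_mem:
  fixes x :: real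
  assumes "1 / 2 \<le> x" "x \<le> 1"
  shows "(1 - x) / x \<in> {0..1}"
  using assms by (auto simp: divide_simps)

lemma farey_left_mono:
  fixes x y :: real
  assumes "0 \<le> x" "x \<le> y" "y \<le> 1 / 2"
  shows "x / (1 - x) \<le> y / (1 - y)"
  using assms by (intro frac_le) auto

lemma farey_right_antimono:
  fixes x y :: real
  assumes "1 / 2 \<le> x" "x \<le> y" "y \<le> 1"
  shows "(1 - y) / y \<le> (1 - x) / x"
  using assms by (intro frac_le) auto

definition unit_cdf :: "(real \<Rightarrow> real) \<Rightarrow> bool" where
  "unit_cdf f \<longleftrightarrow> continuous_on {0..1} f \<and> mono_on {0..1} f \<and> f 0 = 0 \<and> f 1 = 1"

lemma unit_cdf_range:
  assumes "unit_cdf f" "x \<in> {0..1}"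
  shows "f x \<in> {0..1}"
proof -
  have "mono_on {0..1} f"
    using assms by (simp add: unit_cdf_def)
  then have "f 0 \<le> f x" "f x \<le> f 1"
    using assms(2) by (auto intro: mono_onD)
  with assms show ?thesis
    by (auto simp: unit_cdf_def)
qed

text \<open>The two branches glue at \<open>1 / 2\<close> because \<open>f 1 = 1\<close> makes both of them equal to \<open>1 / 2\<close> there. For
  monotonicity the value \<open>1 / 2\<close> also separates the halves, since \<open>f\<close> takes values in the unit
  interval.\<close>

lemma unit_cdf_farey_step:
  assumes f: "unit_cdf f"
  shows "unit_cdf (farey_step f)"
proof -
  have cont: "continuous_on {0..1} f" and mono: "mono_on {0..1} f" and
    f0: "f 0 = 0" and f1: "f 1 = 1"
    using f by (auto simp: unit_cdf_def)
  have "continuous_on {0..1/2} (\<lambda>x. f (x / (1 - x)) / 2)"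
    by (intro continuous_intros continuous_on_compose2[OF cont])
      (use farey_left_mem in auto)
  moreover have "continuous_on {1/2..1} (\<lambda>x. 1 - f ((1 - x) / x) / 2)"
    by (intro continuous_intros continuous_on_compose2[OF cont])
      (use farey_right_mem in auto)
  ultimately have "continuous_on ({0..1/2} \<union> {1/2..1})
      (\<lambda>x. if x \<le> 1 / 2 then f (x / (1 - x)) / 2 else 1 - f ((1 - x) / x) / 2)"
  proof (intro continuous_on_If)
    fix x :: real
    assume "x \<in> {1/2..1}" "x \<le> 1/2"
    then have "x = 1/2" by simp
    show "f (x / (1 - x)) / 2 = 1 - f ((1 - x) / x) / 2"
      unfolding \<open>x = 1/2\<close> by (simp add: f1)
  next
    fix x :: real
    assume "x \<in> {0..1/2}" "\<not> x \<le> 1/2"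
    then show "f (x / (1 - x)) / 2 = 1 - f ((1 - x) / x) / 2"
      by simp
  qed auto
  moreover have "{0..1/2} \<union> {1/2..1} = {0..1::real}"
    by auto
  ultimately have 1: "continuous_on {0..1} (farey_step f)"
    by (simp add: farey_step_def[abs_def])
  have 2: "mono_on {0..1} (farey_step f)"
  proof (rule mono_onI)
    fix x y :: real assume xy: "x \<in> {0..1}" "y \<in> {0..1}" "x \<le> y"
    consider "y \<le> 1/2" | "x \<le> 1/2" "1/2 < y" | "1/2 < x"
      by linarith
    then show "farey_step f x \<le> farey_step f y"
    proof cases
      case 1
      then have "f (x / (1 - x)) \<le> f (y / (1 - y))"
        using xy by (intro mono_onD[OF mono] farey_left_mem farey_left_mono) auto
      with 1 xy show ?thesis by (simp add: farey_step_def)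
    next
      case 2
      have "f (x / (1 - x)) \<in> {0..1}" "f ((1 - y) / y) \<in> {0..1}"
        using 2 xy by (intro unit_cdf_range[OF f] farey_left_mem farey_right_mem; simp)+
      with 2 show ?thesis by (simp add: farey_step_def)
    next
      case 3
      then have "f ((1 - y) / y) \<le> f ((1 - x) / x)"
        using xy by (intro mono_onD[OF mono] farey_right_mem farey_right_antimono) auto
      with 3 xy show ?thesis by (simp add: farey_step_def)
    qed
  qed
  show ?thesis
    unfolding unit_cdf_def using 1 2 by (simp add: farey_step_def f0)
qed

lemma unit_cdf_iterate: "unit_cdf ((farey_step ^^ n) id)"
proof (induction n)
  case 0
  show ?case by (auto simp: unit_cdf_def mono_on_def)
next
  case (Suc n)
  then show ?case by (simp add: unit_cdf_farey_step)
qed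

lemma farey_step_contraction:
  assumes fg: "\<And>x. x \<in> {0..1} \<Longrightarrow> \<bar>f x - g x\<bar> \<le> c" and x: "x \<in> {0..1}"
  shows "\<bar>farey_step f x - farey_step g x\<bar> \<le> c / 2"
proof (cases "x \<le> 1 / 2")
  case True
  with x have "\<bar>f (x / (1 - x)) - g (x / (1 - x))\<bar> \<le> c"
    by (intro fg farey_left_mem) auto
  with True show ?thesis
    unfolding farey_step_def if_P[OF True] by linarith
next
  case False
  with x have "\<bar>f ((1 - x) / x) - g ((1 - x) / x)\<bar> \<le> c"
    by (intro fg farey_right_mem) auto
  then show ?thesis
    unfolding farey_step_def if_not_P[OF False] by linarith
qed

lemma iterate_Cauchy_bound:
  assumes "x \<in> {0..1}"
  shows "\<bar>(farey_step ^^ Suc n) id x - (farey_step ^^ n) id x\<bar> \<le> (1 / 2) ^ n"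
  using assms
proof (induction n arbitrary: x)
  case 0
  have "(farey_step ^^ Suc 0) id x \<in> {0..1}" "(farey_step ^^ 0) id x \<in> {0..1}"
    using 0 by (intro unit_cdf_range[OF unit_cdf_iterate]; simp)+
  then show ?case
    unfolding atLeastAtMost_iff power_0 by linarith
next
  case (Suc n)
  from farey_step_contraction[OF Suc.IH Suc.prems] show ?case
    by simp
qed

text \<open>Consecutive iterates differ by at most \<open>(1 / 2) ^ n\<close>, as each application of the operator halves the
  distance; the telescoping series of the differences then converges by the Weierstrass test.\<close>

lemma iterate_uniform_limit:
  "uniform_limit {0..1} (\<lambda>n. (farey_step ^^ n) id) question_mark sequentially"
proof -
  define g where "g n = (farey_step ^^ n) id" for n
  define S where "S x = (\<Sum>i. g (Suc i) x - g i x)" for x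
  have "uniform_limit {0..1} (\<lambda>n x. \<Sum>i<n. g (Suc i) x - g i x) S sequentially"
    unfolding S_def[abs_def]
  proof (rule Weierstrass_m_test)
    show "norm (g (Suc n) x - g n x) \<le> (1 / 2) ^ n" if "x \<in> {0..1}" for n x
      using iterate_Cauchy_bound[OF that] by (simp add: g_def)
  qed (simp add: summable_geometric)
  moreover have "(\<Sum>i<n. g (Suc i) x - g i x) = g n x - x" for n x
    using sum_lessThan_telescope[of "\<lambda>i. g i x" n] by (simp add: g_def)
  ultimately have "uniform_limit {0..1} (\<lambda>n x. g n x - x) S sequentially"
    by simp
  from uniform_limit_add[OF this uniform_limit_const[where c = "\<lambda>x. x"]]
  have lim: "uniform_limit {0..1} g (\<lambda>x. S x + x) sequentially"
    by (simp add: fun_eq_iff)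
  have "question_mark x = S x + x" if "x \<in> {0..1}" for x
    using tendsto_uniform_limitI[OF lim that] unfolding question_mark_def g_def
    by (rule limI)
  with lim show ?thesis
    unfolding g_def by (subst uniform_limit_cong') auto
qed

lemma iterate_tendsto:
  "x \<in> {0..1} \<Longrightarrow> (\<lambda>n. (farey_step ^^ n) id x) \<longlonglongrightarrow> question_mark x"
  by (rule tendsto_uniform_limitI[OF iterate_uniform_limit])

lemma unit_cdf_question_mark: "unit_cdf question_mark"
  unfolding unit_cdf_def
proof (intro conjI)
  note it = unit_cdf_iterate[unfolded unit_cdf_def]
  show "continuous_on {0..1} question_mark"
    by (rule uniform_limit_theorem[OF _ iterate_uniform_limit]) (use it in auto)
  show "mono_on {0..1} question_mark"
  proof (rule mono_onI)
    fix x y :: real assume xy: "x \<in> {0..1}" "y \<in> {0..1}" "x \<le> y"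
    then have "(farey_step ^^ n) id x \<le> (farey_step ^^ n) id y" for n
      by (intro mono_onD[of "{0..1}" "(farey_step ^^ n) id"]) (use it in auto)
    with xy show "question_mark x \<le> question_mark y"
      by (intro LIMSEQ_le[OF iterate_tendsto iterate_tendsto]) auto
  qed
  show "question_mark 0 = 0" "question_mark 1 = 1"
    using it by (simp_all add: question_mark_def)
qed

lemmas question_mark_continuous = unit_cdf_question_mark[unfolded unit_cdf_def, THEN conjunct1]

lemma question_mark_0: "question_mark 0 = 0" and question_mark_1: "question_mark 1 = 1"
  using unit_cdf_question_mark by (auto simp: unit_cdf_def)

lemma question_mark_mono:
  "0 \<le> x \<Longrightarrow> x \<le> y \<Longrightarrow> y \<le> 1 \<Longrightarrow> question_mark x \<le> question_mark y"
  using unit_cdf_question_mark unfolding unit_cdf_def by (auto elim!: mono_onD)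

lemma question_mark_fixed_point:
  assumes x: "x \<in> {0..1}"
  shows "question_mark x = farey_step question_mark x"
proof -
  have "(\<lambda>n. (farey_step ^^ Suc n) id x) \<longlonglongrightarrow> farey_step question_mark x"
  proof (cases "x \<le> 1 / 2")
    case True
    with x have "x / (1 - x) \<in> {0..1}" by (intro farey_left_mem) auto
    from iterate_tendsto[OF this] True show ?thesis
      by (auto simp: farey_step_def intro!: tendsto_intros)
  next
    case False
    with x have "(1 - x) / x \<in> {0..1}" by (intro farey_right_mem) auto
    from iterate_tendsto[OF this] False show ?thesis
      by (auto simp: farey_step_def intro!: tendsto_intros)
  qed
  moreover have "(\<lambda>n. (farey_step ^^ Suc n) id x) \<longlonglongrightarrow> question_mark x"
    by (rule LIMSEQ_Suc[OF iterate_tendsto[OF x]])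
  ultimately show ?thesis
    by (rule LIMSEQ_unique[symmetric])
qed

text \<open>This identity and the next are the fixed point equation, written with the inverse branches
  \<open>x / (1 + x)\<close> and \<open>1 / (1 + x)\<close> of the Farey map.\<close>

lemma question_mark_left:
  assumes "x \<in> {0..1}"
  shows "question_mark (x / (1 + x)) = question_mark x / 2"
proof -
  have 1: "x / (1 + x) \<in> {0..1}" and 2: "x / (1 + x) \<le> 1 / 2"
    using assms by (auto simp: divide_simps)
  have 3: "(x / (1 + x)) / (1 - x / (1 + x)) = x"
    using assms by (auto simp: field_simps)
  show ?thesis
    by (subst question_mark_fixed_point[OF 1]) (simp only: farey_step_def if_P[OF 2] 3)
qed

lemma question_mark_right:
  assumes "x \<in> {0..1}"
  shows "question_mark (1 / (1 + x)) = 1 - question_mark x / 2"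
proof (cases "x = 1")
  case True
  then show ?thesis
    using question_mark_left[of 1] question_mark_1 by simp
next
  case False
  then have 1: "1 / (1 + x) \<in> {0..1}" and 2: "\<not> 1 / (1 + x) \<le> 1 / 2"
    using assms by (auto simp: divide_simps)
  have 3: "(1 - 1 / (1 + x)) / (1 / (1 + x)) = x"
    using assms by (auto simp: field_simps)
  show ?thesis
    by (subst question_mark_fixed_point[OF 1]) (simp only: farey_step_def if_not_P[OF 2] 3)
qed

text \<open>The reflection exchanges the images \<open>x / (1 + x)\<close> and \<open>1 / (1 + x)\<close> of one point \<open>x\<close> under the two
  inverse branches, and the values there, \<open>q x / 2\<close> and \<open>1 - q x / 2\<close>, add up to \<open>1\<close>.\<close>

lemma question_mark_flip:
  assumes "x \<in> {0..1}"
  shows "question_mark (1 - x) = 1 - question_mark x"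
proof -
  have *: "question_mark (1 - 1 / (1 + y)) = 1 - question_mark (1 / (1 + y))"
    if "y \<in> {0..1}" for y
  proof -
    have "1 - 1 / (1 + y) = y / (1 + y)"
      using that by (auto simp: field_simps)
    then show ?thesis
      using question_mark_left[OF that] question_mark_right[OF that] by simp
  qed
  have **: "question_mark (1 - z) = 1 - question_mark z" if "1 / 2 \<le> z" "z \<le> 1" for z
    using *[OF farey_right_mem[OF that]] that by (simp add: field_simps)
  show ?thesis
    using **[of x] **[of "1 - x"] assms by (cases "1 / 2 \<le> x") auto
qed

text \<open>Applying \<open>y \<mapsto> y / (1 + y)\<close> to \<open>1 / (k + x)\<close> gives \<open>1 / (k + 1 + x)\<close>, so raising the leading partial
  quotient by one halves the value.\<close>

lemma question_mark_inverse_shift: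
  assumes "x \<in> {0..1}" "0 < k"
  shows "question_mark (1 / (real k + x)) = 2 / 2 ^ k - question_mark x / 2 ^ k"
  using assms(2)
proof (induction k)
  case (Suc k)
  show ?case
  proof (cases "k = 0")
    case True
    then show ?thesis using question_mark_right[OF assms(1)] by simp
  next
    case False
    have "1 / (real k + x) \<in> {0..1}"
      using False assms(1) by (auto simp: divide_simps)
    moreover have "(1 / (real k + x)) / (1 + 1 / (real k + x)) = 1 / (real (Suc k) + x)"
      using False assms(1) by (auto simp: field_simps)
    ultimately have "question_mark (1 / (real (Suc k) + x)) = question_mark (1 / (real k + x)) / 2"
      using question_mark_left by metis
    also have "\<dots> = 2 / 2 ^ Suc k - question_mark x / 2 ^ Suc k"
      using False Suc.IH by (simp add: diff_divide_distrib)
    finally show ?thesis .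
  qed
qed simp

section \<open>Values at continued fractions\<close>

lemma cf_truncated_mem:
  assumes "\<And>j. 0 < k j"
  shows "cf_truncated n k \<in> {0..1}"
  using assms
proof (induction n arbitrary: k)
  case (Suc n)
  have "cf_truncated n (\<lambda>j. k (Suc j)) \<in> {0..1}"
    using Suc by auto
  moreover have "1 \<le> real (k 0)"
    using Suc.prems[of 0] by simp
  ultimately show ?case
    by (auto simp: divide_simps)
qed simp

text \<open>Prepending a partial quotient \<open>k\<close> acts on the value and on the partial sum by the same affine map
  \<open>v \<mapsto> 2 / 2 ^ k - v / 2 ^ k\<close>; the empty continued fraction is \<open>0\<close>, where the function vanishes and the
  sum is empty.\<close>

lemma question_mark_cf_truncated:
  assumes "\<And>j. 0 < k j"
  shows "question_mark (cf_truncated n k) =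
    2 * (\<Sum>i<n. (-1) ^ i * (1 / 2 ^ (\<Sum>j\<le>i. k j)))"
  using assms
proof (induction n arbitrary: k)
  case 0
  show ?case by (simp add: question_mark_0)
next
  case (Suc n)
  let ?k' = "\<lambda>j. k (Suc j)"
  have "question_mark (cf_truncated (Suc n) k) =
      2 / 2 ^ k 0 - question_mark (cf_truncated n ?k') / 2 ^ k 0"
    using question_mark_inverse_shift[OF cf_truncated_mem, of ?k' "k 0" n] Suc.prems by simp
  also have "question_mark (cf_truncated n ?k') =
      2 * (\<Sum>i<n. (-1) ^ i * (1 / 2 ^ (\<Sum>j\<le>i. ?k' j)))"
    using Suc.prems by (intro Suc.IH)
  finally have eq: "question_mark (cf_truncated (Suc n) k) = 2 * (1 / 2 ^ k 0
      - (\<Sum>i<n. (-1) ^ i * (1 / 2 ^ (\<Sum>j\<le>i. ?k' j))) / 2 ^ k 0)"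
    by simp
  have "- ((\<Sum>i<n. (-1) ^ i * (1 / 2 ^ (\<Sum>j\<le>i. ?k' j))) / 2 ^ k 0) =
      (\<Sum>i<n. (-1) ^ Suc i * (1 / 2 ^ (\<Sum>j\<le>Suc i. k j)) :: real)"
    unfolding sum_divide_distrib sum_negf[symmetric] sum.atMost_Suc_shift power_add
    by (intro sum.cong) auto
  then have "1 / 2 ^ k 0 - (\<Sum>i<n. (-1) ^ i * (1 / 2 ^ (\<Sum>j\<le>i. ?k' j))) / 2 ^ k 0 =
      (\<Sum>i<Suc n. (-1) ^ i * (1 / 2 ^ (\<Sum>j\<le>i. k j)) :: real)"
    unfolding sum.lessThan_Suc_shift by simp
  then show ?case
    unfolding eq by (rule arg_cong)
qed

lemma cf_expansion_mem:
  assumes "cf_expansion k x"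
  shows "x \<in> {0..1}"
proof -
  have "\<forall>n. cf_truncated n k \<in> {0..1}"
    using assms by (intro allI cf_truncated_mem) (simp add: cf_expansion_def)
  moreover have "(\<lambda>n. cf_truncated n k) \<longlonglongrightarrow> x"
    using assms by (simp add: cf_expansion_def)
  ultimately show ?thesis
    using closed_sequentially[of "{0..1::real}" "\<lambda>n. cf_truncated n k" x] by simp
qed

lemma question_mark_cf_expansion:
  assumes "cf_expansion k x"
  shows "question_mark x = 2 * (\<Sum>n. (-1) ^ n * (1 / 2 ^ (\<Sum>j\<le>n. k j)))"
proof -
  have pos: "0 < k j" for j
    using assms by (simp add: cf_expansion_def)
  have "(\<lambda>n. question_mark (cf_truncated n k)) \<longlonglongrightarrow> question_mark x"
  proof (rule continuous_on_tendsto_compose[OF question_mark_continuous])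
    show "(\<lambda>n. cf_truncated n k) \<longlonglongrightarrow> x"
      using assms by (simp add: cf_expansion_def)
    show "x \<in> {0..1}"
      using assms by (rule cf_expansion_mem)
    show "\<forall>\<^sub>F n in sequentially. cf_truncated n k \<in> {0..1}"
      by (intro always_eventually allI cf_truncated_mem pos)
  qed
  from tendsto_mult_left[OF this, of "1 / 2"]
  have "(\<lambda>n. (-1) ^ n * (1 / 2 ^ (\<Sum>j\<le>n. k j))) sums (question_mark x / 2)"
    by (simp add: sums_def question_mark_cf_truncated[OF pos])
  then show ?thesis
    by (simp add: sums_iff)
qed

text \<open>Since \<open>1 / x - k 0\<close> is again a limit of truncations, it lies in the unit interval; irrationality
  excludes the endpoint \<open>1\<close>, which forces \<open>k 0\<close> to be the integer part of \<open>1 / x\<close>.\<close>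

lemma cf_expansion_tail:
  assumes k: "cf_expansion k x" and x: "x \<notin> \<rat>"
  shows "cf_expansion (\<lambda>j. k (Suc j)) (1 / x - k 0)" and "1 / x - k 0 \<notin> \<rat>"
    and "k 0 = nat \<lfloor>1 / x\<rfloor>"
proof -
  have "x \<noteq> 0"
    using x by auto
  have "(\<lambda>n. cf_truncated (Suc n) k) \<longlonglongrightarrow> x"
    using k by (intro LIMSEQ_Suc) (simp add: cf_expansion_def)
  then have "(\<lambda>n. 1 / cf_truncated (Suc n) k - k 0) \<longlonglongrightarrow> 1 / x - k 0"
    using \<open>x \<noteq> 0\<close> by (intro tendsto_intros)
  then show tail: "cf_expansion (\<lambda>j. k (Suc j)) (1 / x - k 0)"
    using k by (simp add: cf_expansion_def)
  show irr: "1 / x - k 0 \<notin> \<rat>"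
  proof
    assume "1 / x - k 0 \<in> \<rat>"
    then have "1 / (1 / x - k 0 + real (k 0)) \<in> \<rat>"
      by (intro Rats_divide Rats_add Rats_1 Rats_of_nat)
    with x show False by simp
  qed
  have "1 / x - k 0 \<in> {0..1}"
    using tail by (rule cf_expansion_mem)
  moreover have "1 / x - k 0 \<noteq> 1"
    using irr by auto
  ultimately have "\<lfloor>1 / x\<rfloor> = int (k 0)"
    by (intro floor_unique) auto
  then show "k 0 = nat \<lfloor>1 / x\<rfloor>"
    by simp
qed

lemma cf_expansion_unique:
  assumes "cf_expansion k x" "cf_expansion l x" "x \<notin> \<rat>"
  shows "k = l"
proof
  fix n
  show "k n = l n"
    using assms
  proof (induction n arbitrary: k l x)
    case 0
    then show ?case
      using cf_expansion_tail(3)[of k x] cf_expansion_tail(3)[of l x] by simp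
  next
    case (Suc n)
    note k = cf_expansion_tail[OF Suc.prems(1,3)] and l = cf_expansion_tail[OF Suc.prems(2,3)]
    have "k 0 = l 0"
      unfolding k(3) l(3) ..
    with l(1) have "cf_expansion (\<lambda>j. l (Suc j)) (1 / x - k 0)"
      by simp
    with k show ?case
      by (intro Suc.IH)
  qed
qed

section \<open>Existence of continued fraction expansions\<close>

definition gauss_map :: "real \<Rightarrow> real" where
  "gauss_map x = frac (1 / x)"

definition partial_quotients :: "real \<Rightarrow> nat \<Rightarrow> nat" where
  "partial_quotients x n = nat \<lfloor>1 / (gauss_map ^^ n) x\<rfloor>"

lemma gauss_map_irrational:
  assumes "x \<in> {0<..<1} - \<rat>"
  shows "gauss_map x \<in> {0<..<1} - \<rat>"
proof -
  have "1 / x \<notin> \<rat>"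
    using assms Rats_divide[of 1 "1 / x"] by auto
  then have irr: "gauss_map x \<notin> \<rat>"
    unfolding gauss_map_def frac_def
    using Rats_add[of "1 / x - of_int \<lfloor>1 / x\<rfloor>" "of_int \<lfloor>1 / x\<rfloor>"] by auto
  then have "gauss_map x \<noteq> 0"
    by auto
  with irr show ?thesis
    unfolding gauss_map_def using frac_ge_0[of "1 / x"] frac_lt_1[of "1 / x"] by auto
qed

lemma partial_quotients_pos:
  assumes "x \<in> {0<..<1} - \<rat>"
  shows "0 < partial_quotients x n"
proof -
  have "(gauss_map ^^ n) x \<in> {0<..<1} - \<rat>"
    by (induction n) (use assms gauss_map_irrational in auto)
  then show ?thesis
    by (simp add: partial_quotients_def)
qed

lemma partial_quotients_Suc: "partial_quotients x (Suc j) = partial_quotients (gauss_map x) j"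
  by (simp add: partial_quotients_def funpow_swap1)

lemma partial_quotients_0:
  assumes "x \<in> {0<..<1} - \<rat>"
  shows "x = 1 / (real (partial_quotients x 0) + gauss_map x)"
  using assms by (simp add: partial_quotients_def gauss_map_def frac_def)

text \<open>A single map \<open>y \<mapsto> 1 / (a + y)\<close> need not contract uniformly, as its derivative at \<open>0\<close> is \<open>-1\<close> when
  \<open>a = 1\<close>. The composition of two such maps is \<open>y \<mapsto> (b + y) / (a * (b + y) + 1)\<close>, a homography of
  determinant \<open>1\<close> whose denominator is at least \<open>2\<close>.\<close>

lemma continued_fraction_two_steps:
  fixes a b y z :: real
  assumes "1 \<le> a" "1 \<le> b" "0 \<le> y" "0 \<le> z"
  shows "\<bar>1 / (a + 1 / (b + y)) - 1 / (a + 1 / (b + z))\<bar> \<le> \<bar>y - z\<bar> / 2"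
proof -
  define u v where "u = a * (b + y) + 1" and "v = a * (b + z) + 1"
  have "1 * 1 \<le> a * (b + y)" "1 * 1 \<le> a * (b + z)"
    using assms by (intro mult_mono; simp)+
  then have uv: "2 \<le> u" "1 \<le> v"
    by (auto simp: u_def v_def)
  then have "2 * 1 \<le> u * v"
    by (intro mult_mono) auto
  have "1 / (a + 1 / (b + y)) = (b + y) / u" "1 / (a + 1 / (b + z)) = (b + z) / v"
    using assms uv by (auto simp: u_def v_def divide_simps)
  then have "1 / (a + 1 / (b + y)) - 1 / (a + 1 / (b + z)) = ((b + y) * v - (b + z) * u) / (u * v)"
    using uv by (simp add: diff_frac_eq)
  also have "(b + y) * v - (b + z) * u = y - z"
    by (simp add: u_def v_def algebra_simps)
  finally have "\<bar>1 / (a + 1 / (b + y)) - 1 / (a + 1 / (b + z))\<bar> = \<bar>y - z\<bar> / (u * v)"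
    using uv by simp
  also have "\<dots> \<le> \<bar>y - z\<bar> / 2"
    using \<open>2 * 1 \<le> u * v\<close> by (intro divide_left_mono) auto
  finally show ?thesis .
qed

lemma cf_truncated_error:
  assumes "x \<in> {0<..<1} - \<rat>"
  shows "\<bar>x - cf_truncated n (partial_quotients x)\<bar> \<le> (1 / 2) ^ (n div 2)"
  using assms
proof (induction n arbitrary: x rule: less_induct)
  case (less n)
  consider "n = 0" | "n = 1" | m where "n = Suc (Suc m)"
    by (metis One_nat_def not0_implies_Suc)
  then show ?case
  proof cases
    case 3
    define y where "y = gauss_map (gauss_map x)"
    define t where "t = cf_truncated m (partial_quotients y)"
    define a b where "a = partial_quotients x 0" and "b = partial_quotients (gauss_map x) 0"
    note irr = less.prems gauss_map_irrational[OF less.prems]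
    have y: "y \<in> {0<..<1} - \<rat>"
      unfolding y_def using irr by (intro gauss_map_irrational)
    have t: "t \<in> {0..1}"
      unfolding t_def using y by (intro cf_truncated_mem partial_quotients_pos)
    have "0 < a" "0 < b"
      unfolding a_def b_def by (intro partial_quotients_pos irr)+
    then have ab: "1 \<le> real a" "1 \<le> real b"
      by auto
    have x_eq: "1 / (a + 1 / (b + y)) = x"
    proof -
      have "1 / (b + y) = gauss_map x"
        unfolding b_def y_def by (rule partial_quotients_0[OF irr(2), symmetric])
      then show ?thesis
        unfolding a_def by (simp only: partial_quotients_0[OF irr(1), symmetric])
    qed
    have t_eq: "cf_truncated n (partial_quotients x) = 1 / (a + 1 / (b + t))"
      by (simp add: 3 a_def b_def t_def y_def partial_quotients_Suc)
    have "\<bar>x - cf_truncated n (partial_quotients x)\<bar> \<le> \<bar>y - t\<bar> / 2"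
      using continued_fraction_two_steps[of a b y t] ab y t unfolding x_eq t_eq by auto
    also have "\<bar>y - t\<bar> \<le> (1 / 2) ^ (m div 2)"
      unfolding t_def using 3 y by (intro less.IH) auto
    finally show ?thesis
      by (simp add: 3)
  next
    case 2
    have "cf_truncated n (partial_quotients x) \<in> {0..1}"
      using less.prems by (intro cf_truncated_mem partial_quotients_pos)
    then have "\<bar>x - cf_truncated n (partial_quotients x)\<bar> \<le> 1"
      using less.prems by auto
    with 2 show ?thesis by simp
  qed (use less.prems in auto)
qed

lemma cf_expansion_exists:
  assumes "x \<in> {0<..<1} - \<rat>"
  shows "cf_expansion (partial_quotients x) x"
proof -
  have "filterlim (\<lambda>n::nat. n div 2) at_top sequentially"
    by (rule filterlim_at_top_div_const_nat) simp
  then have "(\<lambda>n. (1 / 2 :: real) ^ (n div 2)) \<longlonglongrightarrow> 0"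
    by (intro filterlim_compose[OF LIMSEQ_power_zero[of "1 / 2 :: real"]]) simp_all
  then have "(\<lambda>n. x - cf_truncated n (partial_quotients x)) \<longlonglongrightarrow> 0"
    by (rule Lim_null_comparison[rotated]) (simp add: cf_truncated_error[OF assms])
  from tendsto_diff[OF tendsto_const[of x] this] show ?thesis
    using partial_quotients_pos[OF assms] by (simp add: cf_expansion_def)
qed

section \<open>Identification with the Minkowski function\<close>

lemma minkowski_irrational_eq:
  assumes "x \<in> {0<..<1} - \<rat>"
  shows "minkowski_irrational x = question_mark x"
proof -
  note k = cf_expansion_exists[OF assms]
  have "(THE k. cf_expansion k x) = partial_quotients x"
    using k assms by (intro the_equality cf_expansion_unique[of _ x]) auto
  then show ?thesis
    using question_mark_cf_expansion[OF k] by (simp add: minkowski_irrational_def)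
qed

text \<open>Every interval contains irrational points because it is uncountable. At \<open>x = 1\<close> the approach has to
  be from the left; at all other points the approach from the right is available.\<close>

lemma islimpt_irrationals:
  fixes x :: real
  assumes "x \<in> {0..1}"
  shows "x islimpt ({0<..<1} - \<rat>)"
  unfolding islimpt_approachable
proof safe
  fix e :: real assume "0 < e"
  define a b where "a = (if x = 1 then max 0 (1 - e) else x)" and
    "b = (if x = 1 then 1 else min 1 (x + e))"
  have "a < b"
    using \<open>0 < e\<close> assms by (auto simp: a_def b_def)
  then have "uncountable ({a<..<b} - \<rat>)"
    by (intro uncountable_minus_countable countable_rat) (simp add: uncountable_open_interval)
  then obtain y where "y \<in> {a<..<b} - \<rat>"
    by (metis all_not_in_conv countable_empty)
  then show "\<exists>y\<in>{0<..<1} - \<rat>. y \<noteq> x \<and> dist y x < e"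
    using assms by (intro bexI[of _ y]) (auto simp: a_def b_def dist_real_def split: if_splits)
qed

text \<open>At the rational points, and at the endpoints with their one-sided limits, continuity of
  \<^const>\<open>question_mark\<close> evaluates the limit along irrational points.\<close>

lemma minkowski_eq_question_mark:
  assumes x: "x \<in> {0..1}"
  shows "minkowski x = question_mark x"
proof (cases "x \<in> {0<..<1} - \<rat>")
  case True
  then show ?thesis
    by (simp add: minkowski_def minkowski_irrational_eq)
next
  case False
  let ?F = "at x within ({0<..<1} - \<rat>)"
  have "(question_mark \<longlongrightarrow> question_mark x) (at x within {0..1})"
    using question_mark_continuous x by (simp add: continuous_on_def)
  then have "(question_mark \<longlongrightarrow> question_mark x) ?F"
    by (rule tendsto_within_subset) auto
  moreover have "eventually (\<lambda>y. minkowski_irrational y = question_mark y) ?F"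
    using minkowski_irrational_eq by (auto simp: eventually_at_filter)
  ultimately have "(minkowski_irrational \<longlongrightarrow> question_mark x) ?F"
    by (simp cong: tendsto_cong)
  moreover have "\<not> trivial_limit ?F"
    using islimpt_irrationals[OF x] by (simp add: trivial_limit_within)
  ultimately show ?thesis
    unfolding minkowski_def if_not_P[OF False] by (intro tendsto_Lim)
qed

section \<open>The measure with the question mark function as distribution function\<close>

text \<open>The clamping extends the distribution function to the whole line by \<open>0\<close> and \<open>1\<close>; no mass lies
  outside the unit interval, and the restriction makes it the state space.\<close>

definition minkowski_measure :: "real measure" where
  "minkowski_measure =
    restrict_space (interval_measure (\<lambda>x. question_mark (max 0 (min 1 x)))) {0..1}"

lemma sets_minkowski_measure [simp, measurable_cong]:
  "sets minkowski_measure = sets unit_borel"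
  by (simp add: minkowski_measure_def sets_restrict_space)

lemma space_minkowski_measure [simp]: "space minkowski_measure = {0..1}"
  by (simp add: minkowski_measure_def space_restrict_space)

lemma emeasure_minkowski_measure_Icc:
  assumes "0 \<le> a" "a \<le> b" "b \<le> 1"
  shows "emeasure minkowski_measure {a..b} = ennreal (question_mark b - question_mark a)"
proof -
  let ?F = "\<lambda>x::real. question_mark (max 0 (min 1 x))"
  have "emeasure minkowski_measure {a..b} = emeasure (interval_measure ?F) {a..b}"
    unfolding minkowski_measure_def using assms by (intro emeasure_restrict_space) auto
  also have "\<dots> = ennreal (?F b - ?F a)"
  proof (rule emeasure_interval_measure_Icc)
    show "?F x \<le> ?F y" if "x \<le> y" for x y
      using that by (intro question_mark_mono) auto
    show "continuous_on UNIV ?F"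
      by (intro continuous_on_compose2[OF question_mark_continuous] continuous_intros) auto
  qed (use assms in simp)
  finally show ?thesis
    using assms by simp
qed

lemma measure_minkowski_measure_Icc:
  assumes "0 \<le> a" "a \<le> b" "b \<le> 1"
  shows "measure minkowski_measure {a..b} = question_mark b - question_mark a"
  using assms question_mark_mono[of a b]
  by (simp add: measure_def emeasure_minkowski_measure_Icc)

lemma prob_space_minkowski_measure: "prob_space minkowski_measure"
  by (rule prob_spaceI)
    (simp add: emeasure_minkowski_measure_Icc question_mark_0 question_mark_1)

lemma Icc_in_unit_borel: "0 \<le> a \<Longrightarrow> b \<le> 1 \<Longrightarrow> {a..b} \<in> sets unit_borel"
  by (subst sets_restrict_space_iff) auto

text \<open>Carried to the whole line by the inclusion, both measures have the same distribution function.\<close>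

lemma measure_eqI_unit_cdf:
  fixes N1 N2 :: "real measure"
  assumes "prob_space N1" "prob_space N2"
    and sets: "sets N1 = sets unit_borel" "sets N2 = sets unit_borel"
    and cdf: "\<And>x. x \<in> {0..1} \<Longrightarrow> measure N1 {0..x} = measure N2 {0..x}"
  shows "N1 = N2"
proof (rule measure_eqI)
  show "sets N1 = sets N2"
    by (simp add: sets)
  have id: "(\<lambda>x. x) \<in> N \<rightarrow>\<^sub>M borel" if "sets N = sets unit_borel" for N :: "real measure"
    using measurable_restrict_space1[of "\<lambda>x. x" borel borel "{0..1}"]
    by (simp add: measurable_cong_sets[OF that refl])
  have space: "space N = {0..1}" if "sets N = sets unit_borel" for N :: "real measure"
    using sets_eq_imp_space_eq[OF that] by (simp add: space_restrict_space)
  have cdf_distr: "cdf (distr N borel (\<lambda>x. x)) x =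
      (if x < 0 then 0 else if x \<le> 1 then measure N {0..x} else 1)"
    if "prob_space N" "sets N = sets unit_borel" for N :: "real measure" and x
  proof -
    have "cdf (distr N borel (\<lambda>x. x)) x = measure N ({..x} \<inter> {0..1})"
      unfolding cdf_def by (subst measure_distr) (auto simp: id that space)
    also have "{..x} \<inter> {0..1} = (if x < 0 then {} else if x \<le> 1 then {0..x} else space N)"
      by (auto simp: space that)
    finally show ?thesis
      using prob_space.prob_space[OF that(1)] by auto
  qed
  have eq: "distr N1 borel (\<lambda>x. x) = distr N2 borel (\<lambda>x. x)"
  proof (rule cdf_unique)
    show "real_distribution (distr N1 borel (\<lambda>x. x))" "real_distribution (distr N2 borel (\<lambda>x. x))"
      using assms id by (auto intro!: prob_space.real_distribution_distr)
    show "cdf (distr N1 borel (\<lambda>x. x)) = cdf (distr N2 borel (\<lambda>x. x))"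
      using assms cdf by (auto simp: fun_eq_iff cdf_distr)
  qed
  fix A assume "A \<in> sets N1"
  then have A: "A \<in> sets borel" "A \<subseteq> {0..1}"
    by (auto simp: sets sets_restrict_space_iff)
  then have "emeasure N A = emeasure (distr N borel (\<lambda>x. x)) A" if "sets N = sets unit_borel" for N
    by (subst emeasure_distr) (auto simp: id that space intro!: arg_cong[where f = "emeasure N"])
  with eq sets show "emeasure N1 A = emeasure N2 A"
    by metis
qed

section \<open>Invariance under one step\<close>

lemma H_mem:
  assumes x: "x \<in> {0..1}"
  shows "H i x \<in> {0..1}"
proof -
  have "min (x / (1 - x)) ((1 - x) / x) \<le> 1"
    using farey_left_mem[of x] farey_right_mem[of x] x
    by (cases "x \<le> 1 / 2") (auto simp: min_le_iff_disj)
  moreover have "1 / (1 + x) \<in> {0..1}" "x / (1 + x) \<in> {0..1}"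
    using x by auto
  ultimately show ?thesis
    using x by (auto simp: H_def)
qed

lemma measurable_H [measurable]: "H i \<in> unit_borel \<rightarrow>\<^sub>M unit_borel"
proof (rule measurable_restrict_space2)
  show "H i \<in> space unit_borel \<rightarrow> {0..1}"
    using H_mem by (auto simp: space_restrict_space)
  have "H i \<in> borel \<rightarrow>\<^sub>M borel"
    unfolding H_def[abs_def] by measurable
  then show "H i \<in> unit_borel \<rightarrow>\<^sub>M borel"
    by (rule measurable_restrict_space1)
qed

text \<open>Each preimage is found by solving \<open>H i w \<le> x\<close> for \<open>w\<close>. For \<open>x = 1\<close> the two intervals in the preimage
  under \<open>H 3\<close> would meet at \<open>1 / 2\<close>; for \<open>x < 1\<close> they are disjoint and their masses add.\<close>

lemma H_preimages:
  assumes x: "0 \<le> x" "x < 1"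
  shows "H 0 -` {0..x} \<inter> {0..1} = {0..x}"
    and "H 1 -` {0..x} \<inter> {0..1} = (if x < 1 / 2 then {} else {(1 - x) / x..1})"
    and "H 2 -` {0..x} \<inter> {0..1} = {1 - x..1}"
    and "H 3 -` {0..x} \<inter> {0..1} = {0..x / (1 + x)} \<union> {1 / (1 + x)..1}"
    and "H 4 -` {0..x} \<inter> {0..1} = (if x < 1 / 2 then {0..x / (1 - x)} else {0..1})"
proof -
  have pre: "H i -` {0..x} \<inter> {0..1} = {w \<in> {0..1}. H i w \<le> x}" for i
    using H_mem by auto
  have lower: "{w \<in> {0..1}. w \<le> c} = {0..c}" if "c \<le> 1" for c :: real
    using that by auto
  have upper: "{w \<in> {0..1}. c \<le> w} = {c..1}" if "0 \<le> c" for c :: real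
    using that by auto
  show "H 0 -` {0..x} \<inter> {0..1} = {0..x}"
    using x by (auto simp: H_def)
  show "H 2 -` {0..x} \<inter> {0..1} = {1 - x..1}"
    using x by (auto simp: H_def)
  show "H 1 -` {0..x} \<inter> {0..1} = (if x < 1 / 2 then {} else {(1 - x) / x..1})"
  proof (cases "x < 1 / 2")
    case True
    have "\<not> H 1 w \<le> x" if "w \<in> {0..1}" for w
    proof -
      have "x * (1 + w) \<le> x * 2"
        using that x by (intro mult_left_mono) auto
      with True have "x * (1 + w) < 1"
        by linarith
      with that show ?thesis by (simp add: H_def pos_divide_le_eq)
    qed
    with True show ?thesis unfolding pre by auto
  next
    case False
    then have "H 1 w \<le> x \<longleftrightarrow> (1 - x) / x \<le> w" if "w \<in> {0..1}" for w
      using that by (auto simp: H_def pos_divide_le_eq algebra_simps)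
    then have "{w \<in> {0..1}. H 1 w \<le> x} = {w \<in> {0..1}. (1 - x) / x \<le> w}"
      by blast
    also have "\<dots> = {(1 - x) / x..1}"
      using x by (intro upper) simp
    finally show ?thesis
      unfolding pre using False by simp
  qed
  show "H 3 -` {0..x} \<inter> {0..1} = {0..x / (1 + x)} \<union> {1 / (1 + x)..1}"
  proof -
    have "H 3 w \<le> x \<longleftrightarrow> w \<le> x / (1 + x) \<or> 1 / (1 + x) \<le> w" if w: "w \<in> {0..1}" for w
    proof (cases "w = 0 \<or> w = 1")
      case True
      with x show ?thesis by (auto simp: H_def)
    next
      case False
      with w have w': "0 < w" "w < 1" by auto
      have "w / (1 - w) \<le> x \<longleftrightarrow> w \<le> x / (1 + x)"
        using x w' by (simp add: pos_divide_le_eq pos_le_divide_eq algebra_simps)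
      moreover have "(1 - w) / w \<le> x \<longleftrightarrow> 1 / (1 + x) \<le> w"
        using x w' by (simp add: pos_divide_le_eq algebra_simps)
      ultimately show ?thesis
        using w' by (simp add: H_def min_le_iff_disj)
    qed
    then have "{w \<in> {0..1}. H 3 w \<le> x} =
        {w \<in> {0..1}. w \<le> x / (1 + x)} \<union> {w \<in> {0..1}. 1 / (1 + x) \<le> w}"
      by blast
    also have "\<dots> = {0..x / (1 + x)} \<union> {1 / (1 + x)..1}"
      using x by (intro arg_cong2[where f = "(\<union>)"] lower upper) auto
    finally show ?thesis
      unfolding pre .
  qed
  show "H 4 -` {0..x} \<inter> {0..1} = (if x < 1 / 2 then {0..x / (1 - x)} else {0..1})"
  proof -
    have iff: "H 4 w \<le> x \<longleftrightarrow> w \<le> x / (1 - x)" if "w \<in> {0..1}" for w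
      using x that by (simp add: H_def pos_divide_le_eq pos_le_divide_eq algebra_simps)
    have *: "{w \<in> {0..1}. H 4 w \<le> x} = {w \<in> {0..1}. w \<le> x / (1 - x)}"
      using iff by blast
    show ?thesis
    proof (cases "x < 1 / 2")
      case True
      then have "x / (1 - x) \<le> 1"
        using x by simp
      from lower[OF this] True show ?thesis
        unfolding pre * by simp
    next
      case False
      then have "1 \<le> x / (1 - x)"
        using x by simp
      then have "w \<le> x / (1 - x)" if "w \<in> {0..1}" for w
        using that by (auto intro: order_trans)
      then have "{w \<in> {0..1}. w \<le> x / (1 - x)} = {0..1}"
        by blast
      with False show ?thesis
        unfolding pre * by simp
    qed
  qed
qed

text \<open>The maps \<open>H 0\<close>, \<open>H 2\<close> and \<open>H 3\<close> preserve the measure individually. The maps \<open>H 1\<close> and \<open>H 4\<close> send all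
  mass to the right and left half of the interval respectively; it is the average of the two
  image measures, formed with the equal weights that \<^const>\<open>rho\<close> gives them, that is the original one.\<close>

lemma measure_H_preimages:
  assumes x: "0 \<le> x" "x < 1"
  shows "measure minkowski_measure (H 0 -` {0..x} \<inter> {0..1}) = question_mark x"
    and "measure minkowski_measure (H 1 -` {0..x} \<inter> {0..1}) +
      measure minkowski_measure (H 4 -` {0..x} \<inter> {0..1}) = 2 * question_mark x"
    and "measure minkowski_measure (H 2 -` {0..x} \<inter> {0..1}) = question_mark x"
    and "measure minkowski_measure (H 3 -` {0..x} \<inter> {0..1}) = question_mark x"
proof -
  interpret mm: prob_space minkowski_measure
    by (rule prob_space_minkowski_measure)
  have Icc: "measure minkowski_measure {a..b} = question_mark b - question_mark a"
    if "0 \<le> a" "a \<le> b" "b \<le> 1" for a b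
    using that by (rule measure_minkowski_measure_Icc)
  show "measure minkowski_measure (H 0 -` {0..x} \<inter> {0..1}) = question_mark x"
    unfolding H_preimages[OF x] using x by (simp add: Icc question_mark_0)
  show "measure minkowski_measure (H 2 -` {0..x} \<inter> {0..1}) = question_mark x"
    unfolding H_preimages[OF x] using x by (simp add: Icc question_mark_1 question_mark_flip)
  show "measure minkowski_measure (H 3 -` {0..x} \<inter> {0..1}) = question_mark x"
  proof -
    have *: "0 \<le> x / (1 + x)" "x / (1 + x) < 1 / (1 + x)" "1 / (1 + x) \<le> 1"
      using x by (auto simp: divide_simps)
    have "measure minkowski_measure ({0..x / (1 + x)} \<union> {1 / (1 + x)..1}) =
        measure minkowski_measure {0..x / (1 + x)} + measure minkowski_measure {1 / (1 + x)..1}"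
      using * x by (intro mm.finite_measure_Union) (auto intro!: Icc_in_unit_borel)
    also have "\<dots> = question_mark (x / (1 + x)) + (1 - question_mark (1 / (1 + x)))"
      using * x by (simp add: Icc question_mark_0 question_mark_1)
    also have "\<dots> = question_mark x"
      using x by (simp add: question_mark_left question_mark_right)
    finally show ?thesis
      unfolding H_preimages[OF x] .
  qed
  show "measure minkowski_measure (H 1 -` {0..x} \<inter> {0..1}) +
      measure minkowski_measure (H 4 -` {0..x} \<inter> {0..1}) = 2 * question_mark x"
  proof (cases "x < 1 / 2")
    case True
    have "question_mark x = question_mark (x / (1 - x)) / 2"
      using question_mark_fixed_point[of x] x True by (simp add: farey_step_def)
    with True x farey_left_mem[of x] show ?thesis
      unfolding H_preimages[OF x] by (simp add: Icc question_mark_0)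
  next
    case False
    have "(1 - x) / x \<in> {0..1}"
      using x False by (intro farey_right_mem) auto
    moreover have "question_mark x = 1 - question_mark ((1 - x) / x) / 2"
    proof (cases "x = 1 / 2")
      \<comment> \<open>The operator uses the left branch at the midpoint, but the formula for the right one holds too.\<close>
      case True
      show ?thesis
        unfolding True using question_mark_right[of 1] by (simp add: question_mark_1)
    next
      case neq: False
      with False show ?thesis
        using question_mark_fixed_point[of x] x by (simp add: farey_step_def)
    qed
    ultimately show ?thesis
      unfolding H_preimages[OF x] using False by (simp add: Icc question_mark_0 question_mark_1)
  qed
qed

text \<open>The left-hand side is the law after one step. By \<open>measure_H_preimages\<close> its distribution function at
  \<open>x < 1\<close> is \<open>(1 / 9 + 2 / 9 * (2 + 1 + 1)) * question_mark x = question_mark x\<close>.\<close>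

lemma minkowski_measure_one_step:
  assumes A: "A \<in> sets unit_borel"
  shows "(\<Sum>i\<le>4. emeasure minkowski_measure (H i -` A \<inter> {0..1}) * ennreal (pmf rho i)) =
    emeasure minkowski_measure A"
proof -
  interpret mm: prob_space minkowski_measure
    by (rule prob_space_minkowski_measure)
  \<comment> \<open>The law after one step, as a measure, so that it is determined by its distribution function.\<close>
  define N where "N = measure_pmf rho \<bind> (\<lambda>i. distr minkowski_measure unit_borel (H i))"
  have H: "H i \<in> minkowski_measure \<rightarrow>\<^sub>M unit_borel" for i
    by simp
  have rho: "measure_pmf rho \<in> space (prob_algebra (count_space UNIV))"
    by (simp add: space_prob_algebra measure_pmf.prob_space_axioms)
  have kernel: "(\<lambda>i. distr minkowski_measure unit_borel (H i))
      \<in> count_space UNIV \<rightarrow>\<^sub>M prob_algebra unit_borel"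
    by (auto simp: space_prob_algebra intro!: mm.prob_space_distr H)
  have N: "emeasure N B =
      (\<Sum>i\<le>4. emeasure minkowski_measure (H i -` B \<inter> {0..1}) * ennreal (pmf rho i))"
    if B: "B \<in> sets unit_borel" for B
  proof -
    have "emeasure N B = (\<integral>\<^sup>+i. emeasure (distr minkowski_measure unit_borel (H i)) B \<partial>measure_pmf rho)"
      unfolding N_def by (rule emeasure_bind_prob_algebra[OF rho kernel B])
    also have "\<dots> = (\<Sum>i\<le>4. emeasure (distr minkowski_measure unit_borel (H i)) B * ennreal (pmf rho i))"
      by (rule nn_integral_measure_pmf_support) (auto simp: set_pmf_eq pmf_rho split: if_splits)
    finally show ?thesis
      by (simp add: emeasure_distr[OF H B])
  qed
  have "N = minkowski_measure"
  proof (rule measure_eqI_unit_cdf)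
    show pN: "prob_space N" and sN: "sets N = sets unit_borel"
      unfolding N_def by (rule prob_space_bind'[OF rho kernel] sets_bind'[OF rho kernel])+
    fix x :: real assume x: "x \<in> {0..1}"
    show "measure N {0..x} = measure minkowski_measure {0..x}"
    proof (cases "x = 1")
      case True
      have "space N = {0..1}"
        using sets_eq_imp_space_eq[OF sN] by (simp add: space_restrict_space)
      then show ?thesis
        using prob_space.prob_space[OF pN] mm.prob_space True by simp
    next
      case False
      with x have x': "0 \<le> x" "x < 1" by auto
      let ?m = "\<lambda>i. measure minkowski_measure (H i -` {0..x} \<inter> {0..1})"
      have "emeasure N {0..x} = (\<Sum>i\<le>4. ennreal (?m i * pmf rho i))"
        using x by (subst N) (auto intro!: Icc_in_unit_borel simp: mm.emeasure_eq_measure ennreal_mult)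
      also have "\<dots> = ennreal (\<Sum>i\<le>4. ?m i * pmf rho i)"
        by (rule sum_ennreal) simp
      finally have "measure N {0..x} = (\<Sum>i\<le>4. ?m i * pmf rho i)"
        by (simp add: measure_def sum_nonneg)
      also have "{..4::nat} = {0, 1, 2, 3, 4}"
        by auto
      also have "(\<Sum>i\<in>{0, 1, 2, 3, 4}. ?m i * pmf rho i) =
          ?m 0 / 9 + 2 / 9 * ((?m 1 + ?m 4) + ?m 2 + ?m 3)"
        by (simp add: pmf_rho)
      also have "\<dots> = question_mark x"
        unfolding measure_H_preimages[OF x'] by simp
      also have "\<dots> = measure minkowski_measure {0..x}"
        using x' by (simp add: measure_minkowski_measure_Icc question_mark_0)
      finally show ?thesis .
    qed
  qed (simp_all add: mm.prob_space_axioms)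
  with N[OF A] show ?thesis
    by simp
qed

section \<open>The chain\<close>

lemma W_mem: "w \<in> {0..1} \<Longrightarrow> W I w n \<omega> \<in> {0..1}"
  by (induction n) (auto simp: H_mem simp del: atLeastAtMost_iff)

lemma measurable_W_pair:
  assumes I: "\<And>i. i \<in> {1..n} \<Longrightarrow> I i \<in> M \<rightarrow>\<^sub>M count_space UNIV"
  shows "(\<lambda>(w, \<omega>). W I w n \<omega>) \<in> unit_borel \<Otimes>\<^sub>M M \<rightarrow>\<^sub>M unit_borel"
  using I
proof (induction n)
  case 0
  show ?case by simp
next
  case (Suc n)
  have [measurable]: "(\<lambda>(w, \<omega>). W I w n \<omega>) \<in> unit_borel \<Otimes>\<^sub>M M \<rightarrow>\<^sub>M unit_borel"
    using Suc.prems by (intro Suc.IH) auto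
  have [measurable]: "I (Suc n) \<in> M \<rightarrow>\<^sub>M count_space UNIV"
    using Suc.prems by auto
  have "(\<lambda>x. H (I (Suc n) (snd x)) (case x of (w, \<omega>) \<Rightarrow> W I w n \<omega>))
      \<in> unit_borel \<Otimes>\<^sub>M M \<rightarrow>\<^sub>M unit_borel"
    by (rule measurable_compose_countable) measurable
  then show ?case
    by (simp add: case_prod_beta')
qed

lemma measurable_W:
  assumes "\<And>i. i \<in> {1..n} \<Longrightarrow> I i \<in> M \<rightarrow>\<^sub>M count_space UNIV" and w: "w \<in> {0..1}"
  shows "W I w n \<in> M \<rightarrow>\<^sub>M unit_borel"
proof -
  have "Pair w \<in> M \<rightarrow>\<^sub>M unit_borel \<Otimes>\<^sub>M M"
    using w by (intro measurable_Pair1') (simp add: space_restrict_space)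
  from measurable_compose[OF this measurable_W_pair[OF assms(1)]] show ?thesis
    by simp
qed

text \<open>The position at time \<open>n\<close> is a function of the first \<open>n\<close> indices, namely the chain itself run on the
  space of index sequences with the coordinates as the driving variables.\<close>

lemma W_restrict:
  assumes "n \<le> m"
  shows "W (\<lambda>i f. f i) w n (\<lambda>i\<in>{1..m}. I i \<omega>) = W I w n \<omega>"
  using assms by (induction n) auto

text \<open>The independence of the families of coordinates \<open>{Suc n}\<close> and \<open>{1..n}\<close>, applied to events that \<open>I (Suc n)\<close>
  and \<open>W I w n\<close> determine.\<close>

lemma (in prob_space) next_map_indep_W:
  assumes indep: "indep_vars (\<lambda>_. count_space UNIV) I {1..}" and w: "w \<in> {0..1}"
    and B: "B \<in> sets unit_borel"
  shows "prob (I (Suc n) -` A \<inter> W I w n -` B \<inter> space M) =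
    prob (I (Suc n) -` A \<inter> space M) * prob (W I w n -` B \<inter> space M)"
proof -
  let ?P = "\<lambda>J. PiM J (\<lambda>_. count_space (UNIV :: nat set))"
  let ?X = "\<lambda>J \<omega>. \<lambda>i\<in>J. I i \<omega>"
  define A' where "A' = (\<lambda>f. f (Suc n)) -` A \<inter> space (?P {Suc n})"
  define B' where "B' = W (\<lambda>i f. f i) w n -` B \<inter> space (?P {1..n})"
  have "A' \<in> sets (?P {Suc n})"
    unfolding A'_def by (rule measurable_sets[OF measurable_component_singleton]) auto
  moreover have "B' \<in> sets (?P {1..n})"
    unfolding B'_def
    by (intro measurable_sets[OF measurable_W B] measurable_component_singleton w)
  moreover have "indep_var (?P {Suc n}) (?X {Suc n}) (?P {1..n}) (?X {1..n})"
    by (rule indep_var_restrict[OF indep]) auto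
  ultimately have "prob ((\<lambda>\<omega>. (?X {Suc n} \<omega>, ?X {1..n} \<omega>)) -` (A' \<times> B') \<inter> space M) =
      prob (?X {Suc n} -` A' \<inter> space M) * prob (?X {1..n} -` B' \<inter> space M)"
    by (intro indep_varD)
  moreover have "?X {Suc n} \<omega> \<in> A' \<longleftrightarrow> I (Suc n) \<omega> \<in> A" for \<omega>
    by (simp add: A'_def space_PiM)
  moreover have "?X {1..n} \<omega> \<in> B' \<longleftrightarrow> W I w n \<omega> \<in> B" for \<omega>
    unfolding B'_def Int_iff vimage_eq W_restrict[OF order_refl] by (simp add: space_PiM)
  ultimately show ?thesis
    by (simp add: vimage_def Int_def conj_ac)
qed

text \<open>The Chapman-Kolmogorov equation for the last step: split the event by the value of \<open>I (Suc n)\<close>,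
  which is independent of the position at time \<open>n\<close>.\<close>

lemma (in prob_space) emeasure_W_Suc:
  assumes indep: "indep_vars (\<lambda>_. count_space UNIV) I {1..}"
    and law: "distr M (count_space UNIV) (I (Suc n)) = measure_pmf rho"
    and range: "\<And>\<omega>. \<omega> \<in> space M \<Longrightarrow> I (Suc n) \<omega> \<le> 4"
    and w: "w \<in> {0..1}" and A: "A \<in> sets unit_borel"
  shows "emeasure (distr M unit_borel (W I w (Suc n))) A =
    (\<Sum>i\<le>4. emeasure (distr M unit_borel (W I w n)) (H i -` A \<inter> {0..1}) * ennreal (pmf rho i))"
proof -
  have I: "I i \<in> M \<rightarrow>\<^sub>M count_space UNIV" if "1 \<le> i" for i
    using indep that by (auto simp: indep_vars_def)
  have W: "W I w m \<in> M \<rightarrow>\<^sub>M unit_borel" for m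
    using w by (intro measurable_W I) auto
  have B: "H i -` A \<inter> {0..1} \<in> sets unit_borel" for i
    using measurable_sets[OF measurable_H A, of i] by (simp add: space_restrict_space)
  define E where
    "E i = I (Suc n) -` {i} \<inter> W I w n -` (H i -` A \<inter> {0..1}) \<inter> space M" for i
  have E: "emeasure M (E i) =
      emeasure (distr M unit_borel (W I w n)) (H i -` A \<inter> {0..1}) * ennreal (pmf rho i)" for i
  proof -
    have "prob (E i) = prob (I (Suc n) -` {i} \<inter> space M) *
        prob (W I w n -` (H i -` A \<inter> {0..1}) \<inter> space M)"
      unfolding E_def by (rule next_map_indep_W[OF indep w B])
    also have "prob (I (Suc n) -` {i} \<inter> space M) = pmf rho i"
      using measure_distr[OF I, of "Suc n" "{i}"] by (simp add: law pmf.rep_eq)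
    finally show ?thesis
      by (simp add: emeasure_distr[OF W B] emeasure_eq_measure ennreal_mult mult.commute)
  qed
  have "emeasure (distr M unit_borel (W I w (Suc n))) A = emeasure M (W I w (Suc n) -` A \<inter> space M)"
    by (rule emeasure_distr[OF W A])
  also have "W I w (Suc n) -` A \<inter> space M = (\<Union>i\<le>4. E i)"
    using range W_mem[OF w, of I n] by (auto simp: E_def)
  also have "emeasure M (\<Union>i\<le>4. E i) = (\<Sum>i\<le>4. emeasure M (E i))"
  proof (rule sum_emeasure[symmetric])
    show "E ` {..4} \<subseteq> events"
    proof safe
      fix i
      have "E i = (I (Suc n) -` {i} \<inter> space M) \<inter>
          (W I w n -` (H i -` A \<inter> {0..1}) \<inter> space M)"
        by (auto simp: E_def)
      also have "\<dots> \<in> events"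
        by (intro sets.Int measurable_sets[OF I] measurable_sets[OF W B]) auto
      finally show "E i \<in> events" .
    qed
    show "disjoint_family_on E {..4}"
      by (auto simp: E_def disjoint_family_on_def)
  qed simp
  finally show ?thesis
    by (simp add: E)
qed

section \<open>Stationarity\<close>

theorem corollary3p2:
  fixes M :: "'a measure" and I :: "nat \<Rightarrow> 'a \<Rightarrow> nat"
  assumes "prob_space M"
    and "prob_space.indep_vars M (\<lambda>_. count_space UNIV) I {1..}"
    and "\<And>n. n \<ge> 1 \<Longrightarrow> distr M (count_space UNIV) (I n) = measure_pmf rho"
    and "\<And>n \<omega>. n \<ge> 1 \<Longrightarrow> \<omega> \<in> space M \<Longrightarrow> I n \<omega> \<in> {0, 1, 2, 3, 4}"
  shows "stationary_distribution_function (\<lambda>n w. distr M unit_borel (W I w n)) minkowski"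
proof -
  interpret prob_space M by fact
  define K where "K n w = distr M unit_borel (W I w n)" for n w
  have I: "I i \<in> M \<rightarrow>\<^sub>M count_space UNIV" if "1 \<le> i" for i
    using assms(2) that by (auto simp: indep_vars_def)
  have mu: "minkowski_measure \<in> space (prob_algebra unit_borel)"
    by (simp add: space_prob_algebra prob_space_minkowski_measure)
  have K: "K n \<in> unit_borel \<rightarrow>\<^sub>M prob_algebra unit_borel" for n
    unfolding K_def[abs_def]
  proof (rule measurable_distr_prob_space2)
    show "(\<lambda>w. M) \<in> unit_borel \<rightarrow>\<^sub>M prob_algebra M"
      by (simp add: space_prob_algebra prob_space_axioms)
    show "(\<lambda>(w, \<omega>). W I w n \<omega>) \<in> unit_borel \<Otimes>\<^sub>M M \<rightarrow>\<^sub>M unit_borel"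
      by (intro measurable_W_pair I) simp
  qed
  have bind: "emeasure (minkowski_measure \<bind> K n) A = (\<integral>\<^sup>+w. emeasure (K n w) A \<partial>minkowski_measure)"
    if "A \<in> sets unit_borel" for n A
    by (rule emeasure_bind_prob_algebra[OF mu K that])
  have invariant: "emeasure (minkowski_measure \<bind> K n) A = emeasure minkowski_measure A"
    if "A \<in> sets unit_borel" for n A
    using that
  proof (induction n arbitrary: A)
    case 0
    have "K 0 w = return unit_borel w" if "w \<in> {0..1}" for w
      unfolding K_def W.simps using that by (subst distr_const) (simp_all add: space_restrict_space)
    then have "emeasure (minkowski_measure \<bind> K 0) A =
        (\<integral>\<^sup>+w. indicator A w \<partial>minkowski_measure)"
      unfolding bind[OF 0] using 0 by (intro nn_integral_cong) simp
    also have "\<dots> = emeasure minkowski_measure A"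
      using 0 by (intro nn_integral_indicator) simp
    finally show ?case .
  next
    case (Suc n)
    have B: "H i -` A \<inter> {0..1} \<in> sets unit_borel" for i
      using measurable_sets[OF measurable_H Suc.prems, of i] by (simp add: space_restrict_space)
    have meas: "(\<lambda>w. emeasure (K n w) (H i -` A \<inter> {0..1})) \<in> borel_measurable minkowski_measure" for i
      using measurable_emeasure_kernel[OF measurable_prob_algebraD[OF K] B]
      by (simp cong: measurable_cong_sets)
    have le4: "I (Suc n) \<omega> \<le> 4" if "\<omega> \<in> space M" for \<omega>
      using assms(4)[of "Suc n" \<omega>] that by auto
    \<comment> \<open>Integrate the last-step equation over the initial law; the induction hypothesis then leaves one step.\<close>
    have "emeasure (minkowski_measure \<bind> K (Suc n)) A =
        (\<integral>\<^sup>+w. (\<Sum>i\<le>4. emeasure (K n w) (H i -` A \<inter> {0..1}) * ennreal (pmf rho i)) \<partial>minkowski_measure)"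
      unfolding bind[OF Suc.prems] K_def
      by (intro nn_integral_cong emeasure_W_Suc assms(2,3) le4 Suc.prems) simp_all
    also have "\<dots> = (\<Sum>i\<le>4. (\<integral>\<^sup>+w. emeasure (K n w) (H i -` A \<inter> {0..1}) \<partial>minkowski_measure)
        * ennreal (pmf rho i))"
      by (subst nn_integral_sum) (simp_all add: nn_integral_multc meas borel_measurable_times_ennreal)
    also have "\<dots> = (\<Sum>i\<le>4. emeasure minkowski_measure (H i -` A \<inter> {0..1}) * ennreal (pmf rho i))"
      unfolding bind[OF B, symmetric] Suc.IH[OF B] ..
    also have "\<dots> = emeasure minkowski_measure A"
      by (rule minkowski_measure_one_step[OF Suc.prems])
    finally show ?case .
  qed
  have "minkowski_measure \<bind> K n = minkowski_measure" for n
  proof (rule measure_eqI)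
    show sets: "sets (minkowski_measure \<bind> K n) = sets minkowski_measure"
      using sets_bind'[OF mu K] by simp
    show "emeasure (minkowski_measure \<bind> K n) A = emeasure minkowski_measure A"
      if "A \<in> sets (minkowski_measure \<bind> K n)" for A
      using that unfolding sets by (intro invariant) simp
  qed
  then have "stationary_distribution unit_borel K minkowski_measure"
    unfolding stationary_distribution_def using mu K by simp
  moreover have "minkowski x = measure minkowski_measure {0..x}" if "x \<in> {0..1}" for x
    using that
    by (simp add: minkowski_eq_question_mark measure_minkowski_measure_Icc question_mark_0)
  ultimately show ?thesis
    unfolding stationary_distribution_function_def K_def[abs_def] by blast
qed

end
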